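(* Let $|\psi\rangle$ be a pure state in $\mathcal{H}_{[n]}=\bigotimes_{i=1}^n\mathcal{H}_i$, and let $\mathcal{S}=\{S_1,S_2,\dots,S_m\}$ be a collection of subsets $S_i\subseteq[n]$ with $\mathcal{S}\neq\{\emptyset\}$. In the $n$-qubit parallelized SWAP test of $|\psi\rangle\langle\psi|$ and $|\psi\rangle\langle\psi|$, the fixed partition measure $E_{\mathcal{S}}$ satisfies $$E_{\mathcal{S}}(|\psi\rangle)=1-\frac{1}{m}\sum_{i=1}^m\sum_{\mathbf{z}\in\mathbb{Z}_2^n}(-1)^{\mathbf{z}\cdot\mathbf{t}_i}\,p(\mathbf{z}),$$ where $\mathbf{t}_i\in\mathbb{Z}_2^n$ is the vector with $\mathrm{supp}(\mathbf{t}_i)=S_i$ for $1\le i\le m$.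
   Context: $[n]=\{1,\dots,n\}$; $\mathcal{H}_{[n]}=\bigotimes_{i=1}^n\mathcal{H}_i$ with $\dim\mathcal{H}_i=d$ for all $i$. A pure state is a unit vector of $\mathcal{H}_{[n]}$. For $S\subseteq[n]$, $S^c=[n]\setminus S$ and $\rho_S=\mathrm{Tr}_{S^c}\rho$ is the reduced state (partial trace); for $S=\emptyset$, $\mathrm{Tr}(\rho_\emptyset^2)=1$. For $\mathbf{z}\in\mathbb{Z}_2^n$, $\mathrm{supp}(\mathbf{z})=\{i:z_i\ne0\}$, and $\mathbf{u}\cdot\mathbf{v}=\sum_i u_iv_i=|\mathrm{supp}(\mathbf{u})\cap\mathrm{supp}(\mathbf{v})|$. For a collection $\mathcal{S}=\{S_1,\dots,S_m\}$ ($m\ge1$) of subsets of $[n]$, $\mathcal{S}\ne\{\emptyset\}$, the fixed partition measure on $\mathcal{S}$ is $$E_{\mathcal{S}}(|\psi\rangle)=1-\frac1m\sum_{i=1}^m\mathrm{Tr}(\rho_{S_i}^2),\qquad \rho=|\psi\rangle\langle\psi|.$$ The $n$-qubit parallelized SWAP test of states $\rho$ and $\sigma$ on $\mathcal{H}_{[n]}$ is the following circuit. There are $n$ ancilla qubits $A_1,\dots,A_n$, and registers $B_1,\dots,B_n$ and $C_1,\dots,C_n$ with $B_i\cong C_i\cong\mathcal{H}_i$. The initial state is $(|0\rangle\langle 0|)^{\otimes n}\otimes\rho\otimes\sigma$, with $\rho$ on $B_1\cdots B_n$ and $\sigma$ on $C_1\cdots C_n$. Apply a Hadamard gate $H$ to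 each ancilla $A_i$; then for each $i$ apply the controlled-SWAP gate with control $A_i$ which swaps $B_i$ and $C_i$ when $A_i$ is in state $|1\rangle$ (and acts trivially when $A_i$ is in state $|0\rangle$); then apply $H$ to each ancilla again; finally measure all ancillas in the computational basis. $p(\mathbf{z})$ denotes the probability of obtaining outcome $\mathbf{z}\in\mathbb{Z}_2^n$. *)

theory Defs
  imports "HOL-Analysis.Analysis" "HOL-Library.Z2"
begin

(* The set [n] is modelled by an index type 'n (finite, linearly ordered), and each local space
   H_i by complex^'d with an arbitrary finite 'd, so d = CARD('d). The computational basis of the
   tensor product of the H_i is indexed by the functions 'n => 'd. *)

instance bit :: finite
proof
  have "(UNIV :: bit set) = {0, 1}"
    by auto
  then show "finite (UNIV :: bit set)"
    by (metis finite.emptyI finite.insertI)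
qed

type_synonym ('n, 'd) state = "complex ^ ('n \<Rightarrow> 'd)"
type_synonym 'b operator = "complex ^ 'b ^ 'b"

(* |v><v| *)
definition ketbra :: "complex ^ 'b \<Rightarrow> 'b operator" where
  "ketbra v = (\<chi> x y. v $ x * cnj (v $ y))"

definition pure_state :: "('n::finite, 'd::finite) state \<Rightarrow> bool" where
  "pure_state \<psi> \<longleftrightarrow> norm \<psi> = 1"


(* The basis of the tensor product of the H_i over i in S is indexed by the extensional functions
   in S \<rightarrow>\<^sub>E UNIV. An operator on that space is given by its matrix entries on this index set;
   for S = {} the index set is a singleton. *)

definition reduced_state ::
  "'n set \<Rightarrow> ('n::finite \<Rightarrow> 'd::finite) operator \<Rightarrow> ('n \<Rightarrow> 'd) \<Rightarrow> ('n \<Rightarrow> 'd) \<Rightarrow> complex" where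
  "reduced_state S \<rho> x y =
     (\<Sum>w \<in> (- S) \<rightarrow>\<^sub>E UNIV. \<rho> $ override_on w x S $ override_on w y S)"

definition op_mult_on ::
  "'b set \<Rightarrow> ('b \<Rightarrow> 'b \<Rightarrow> complex) \<Rightarrow> ('b \<Rightarrow> 'b \<Rightarrow> complex) \<Rightarrow> 'b \<Rightarrow> 'b \<Rightarrow> complex" where
  "op_mult_on I A B x y = (\<Sum>k\<in>I. A x k * B k y)"

definition op_trace_on :: "'b set \<Rightarrow> ('b \<Rightarrow> 'b \<Rightarrow> complex) \<Rightarrow> complex" where
  "op_trace_on I A = (\<Sum>x\<in>I. A x x)"

(* Tr(rho_S^2); Re only converts the type, the trace being real for Hermitian rho. *)
definition purity :: "'n set \<Rightarrow> ('n::finite \<Rightarrow> 'd::finite) operator \<Rightarrow> real" where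
  "purity S \<rho> =
     (let I = S \<rightarrow>\<^sub>E UNIV
      in Re (op_trace_on I (op_mult_on I (reduced_state S \<rho>) (reduced_state S \<rho>))))"

(* The collection is given as the family S 1, ..., S m. *)
definition fixed_partition_measure ::
  "nat \<Rightarrow> (nat \<Rightarrow> 'n set) \<Rightarrow> ('n::finite, 'd::finite) state \<Rightarrow> real" where
  "fixed_partition_measure m S \<psi> = 1 - 1 / real m * (\<Sum>i = 1..m. purity (S i) (ketbra \<psi>))"


definition supp :: "('n \<Rightarrow> bit) \<Rightarrow> 'n set" where
  "supp z = {i. z i \<noteq> 0}"

(* The dot product is an integer here, not an element of Z_2. *)
definition bit_dot :: "('n::finite \<Rightarrow> bit) \<Rightarrow> ('n \<Rightarrow> bit) \<Rightarrow> nat" where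
  "bit_dot u v = card (supp u \<inter> supp v)"


(* Basis of the circuit's space: ancillas A, registers B, registers C. *)
type_synonym ('n, 'd) reg = "('n \<Rightarrow> bit) \<times> ('n \<Rightarrow> 'd) \<times> ('n \<Rightarrow> 'd)"

definition tensor_op :: "'a::finite operator \<Rightarrow> 'b::finite operator \<Rightarrow> ('a \<times> 'b) operator" where
  "tensor_op A B = (\<chi> x y. A $ fst x $ fst y * B $ snd x $ snd y)"

definition adjoint_op :: "'b::finite operator \<Rightarrow> 'b operator" where
  "adjoint_op U = (\<chi> x y. cnj (U $ y $ x))"

definition evolve :: "'b::finite operator \<Rightarrow> 'b operator \<Rightarrow> 'b operator" where
  "evolve U \<rho> = U ** \<rho> ** adjoint_op U"

(* The single-site gate G acting on tensor factor i and as the identity on all the others. *)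
definition gate_at :: "'n::finite \<Rightarrow> 'b::finite operator \<Rightarrow> ('n \<Rightarrow> 'b) operator" where
  "gate_at i G = (\<chi> x y. if \<forall>j. j \<noteq> i \<longrightarrow> x j = y j then G $ x i $ y i else 0)"

definition hadamard :: "bit operator" where
  "hadamard = (\<chi> a b. (if a = 1 \<and> b = 1 then - 1 else 1) / complex_of_real (sqrt 2))"

definition hadamard_gate :: "'n::finite \<Rightarrow> ('n, 'd::finite) reg operator" where
  "hadamard_gate i = tensor_op (gate_at i hadamard) (mat 1)"

definition swap_sites ::
  "'n \<Rightarrow> ('n \<Rightarrow> 'd) \<times> ('n \<Rightarrow> 'd) \<Rightarrow> ('n \<Rightarrow> 'd) \<times> ('n \<Rightarrow> 'd)" where
  "swap_sites i = (\<lambda>(b, c). (b(i := c i), c(i := b i)))"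

definition swap_gate :: "'n::finite \<Rightarrow> (('n \<Rightarrow> 'd::finite) \<times> ('n \<Rightarrow> 'd)) operator" where
  "swap_gate i = (\<chi> x y. if x = swap_sites i y then 1 else 0)"

(* |0><0| (x) I + |1><1| (x) SWAP, with control A_i and target B_i C_i. *)
definition cswap_gate :: "'n::finite \<Rightarrow> ('n, 'd::finite) reg operator" where
  "cswap_gate i = tensor_op (gate_at i (ketbra (axis 0 1))) (mat 1)
                + tensor_op (gate_at i (ketbra (axis 1 1))) (swap_gate i)"

(* Apply g i for every site i, in increasing order of i. *)
definition layer ::
  "('n::{finite,linorder} \<Rightarrow> 'b::finite operator) \<Rightarrow> 'b operator \<Rightarrow> 'b operator" where
  "layer g \<rho> = fold (\<lambda>i. evolve (g i)) (sorted_list_of_set UNIV) \<rho>"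

definition swap_test_initial ::
  "('n::finite \<Rightarrow> 'd::finite) operator \<Rightarrow> ('n \<Rightarrow> 'd) operator \<Rightarrow> ('n, 'd) reg operator" where
  "swap_test_initial \<rho> \<sigma> = tensor_op (ketbra (axis (\<lambda>_. 0) 1)) (tensor_op \<rho> \<sigma>)"

definition swap_test_final ::
  "('n::{finite,linorder} \<Rightarrow> 'd::finite) operator \<Rightarrow> ('n \<Rightarrow> 'd) operator \<Rightarrow> ('n, 'd) reg operator" where
  "swap_test_final \<rho> \<sigma> =
     layer hadamard_gate (layer cswap_gate (layer hadamard_gate (swap_test_initial \<rho> \<sigma>)))"

(* Born rule for the projector |z><z| on the ancillas; Re only converts the type, the trace being
   real for Hermitian rho and sigma. *)
definition swap_test_prob ::
  "('n::{finite,linorder} \<Rightarrow> 'd::finite) operator \<Rightarrow> ('n \<Rightarrow> 'd) operator \<Rightarrow> ('n \<Rightarrow> bit) \<Rightarrow> real" where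
  "swap_test_prob \<rho> \<sigma> z =
     Re (trace (tensor_op (ketbra (axis z 1)) (mat 1) ** swap_test_final \<rho> \<sigma>))"

end

theory Submission
  imports Defs
begin

text \<open>
  The sum over \<open>z\<close> is the expectation of the observable \<open>Z\<close> on the ancillas in \<open>supp t\<close> in the
  final state. The last Hadamard layer turns \<open>Z\<close> into \<open>X\<close>, which flips these ancillas in the state
  \<open>2 ^ (- n / 2) * (\<Sum>a. |a> SWAP_a |\<psi>\<psi>>)\<close>. As \<open>SWAP_a\<close> and \<open>SWAP_(a + t)\<close> differ by \<open>SWAP_t\<close>, each
  \<open>a\<close> contributes the same amount, and the expectation is \<open><\<psi>\<psi>| SWAP_t |\<psi>\<psi>>\<close>, the purity of the
  reduced state on \<open>supp t\<close>.
\<close>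

section \<open>From density operators to state vectors\<close>

lemma UNIV_bit: "(UNIV :: bit set) = {0, 1}"
  by auto

lemma sum_UNIV_prod:
  fixes f :: "'a::finite \<times> 'b::finite \<Rightarrow> 'c::comm_monoid_add"
  shows "(\<Sum>p\<in>UNIV. f p) = (\<Sum>a\<in>UNIV. \<Sum>b\<in>UNIV. f (a, b))"
  by (simp add: sum.cartesian_product)

text \<open>As U |v><v| U* = |Uv><Uv|, a pure input stays pure, and the circuit can be followed on
  vectors.\<close>

lemma evolve_ketbra: "evolve U (ketbra v) = ketbra (U *v v)"
  by (simp add: evolve_def ketbra_def adjoint_op_def matrix_matrix_mult_def
      matrix_vector_mult_def vec_eq_iff sum_distrib_left sum_distrib_right mult_ac)

definition layer_vec ::
  "('n::{finite,linorder} \<Rightarrow> 'b::finite operator) \<Rightarrow> complex ^ 'b \<Rightarrow> complex ^ 'b" where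
  "layer_vec g v = fold (\<lambda>i v. g i *v v) (sorted_list_of_set UNIV) v"

lemma layer_ketbra: "layer g (ketbra v) = ketbra (layer_vec g v)"
proof -
  have "fold (\<lambda>i. evolve (g i)) xs (ketbra v) = ketbra (fold (\<lambda>i v. g i *v v) xs v)" for xs
    by (induction xs arbitrary: v) (simp_all add: evolve_ketbra)
  then show ?thesis
    by (simp add: layer_def layer_vec_def)
qed

definition tensor_vec :: "complex ^ 'a::finite \<Rightarrow> complex ^ 'b::finite \<Rightarrow> complex ^ ('a \<times> 'b)" where
  "tensor_vec u v = (\<chi> x. u $ fst x * v $ snd x)"

lemma tensor_op_ketbra: "tensor_op (ketbra u) (ketbra v) = ketbra (tensor_vec u v)"
  by (simp add: tensor_op_def ketbra_def tensor_vec_def vec_eq_iff)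

lemma tensor_op_mult_vec:
  "(tensor_op A B *v v) $ (a, r) = (\<Sum>a'\<in>UNIV. A $ a $ a' * (\<Sum>r'\<in>UNIV. B $ r $ r' * v $ (a', r')))"
  by (simp add: tensor_op_def matrix_vector_mult_def sum_UNIV_prod sum_distrib_left mult_ac)

section \<open>Layers of single-site gates\<close>

lemma gate_at_sum:
  "(\<Sum>a'\<in>UNIV. gate_at i G $ a $ a' * f a') = (\<Sum>s\<in>UNIV. G $ a i $ s * f (a(i := s)))"
proof -
  have inj: "inj (\<lambda>s. a(i := s))"
    by (rule injI) (metis fun_upd_same)
  have "(\<Sum>a'\<in>UNIV. gate_at i G $ a $ a' * f a')
      = (\<Sum>a'\<in>range (\<lambda>s. a(i := s)). gate_at i G $ a $ a' * f a')"
  proof (rule sum.mono_neutral_right)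
    \<comment> \<open>A nonzero entry in row \<open>a\<close> forces \<open>a'\<close> to agree with
      \<open>a\<close> off \<open>i\<close>, hence \<open>a' = a(i := a' i)\<close>.\<close>
    show "\<forall>a'\<in>UNIV - range (\<lambda>s. a(i := s)). gate_at i G $ a $ a' * f a' = 0"
    proof
      fix a' assume "a' \<in> UNIV - range (\<lambda>s. a(i := s))"
      then have "a' \<noteq> a(i := a' i)"
        by auto
      then have "\<not> (\<forall>j. j \<noteq> i \<longrightarrow> a j = a' j)"
        by (metis fun_upd_apply ext)
      then show "gate_at i G $ a $ a' * f a' = 0"
        by (auto simp: gate_at_def)
    qed
  qed auto
  also have "\<dots> = (\<Sum>s\<in>UNIV. G $ a i $ s * f (a(i := s)))"
    by (simp add: sum.reindex[OF inj] gate_at_def)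
  finally show ?thesis .
qed

lemma mat_1_sum: "(\<Sum>r'\<in>UNIV. (mat 1 :: complex ^ 'b ^ 'b::finite) $ r $ r' * f r') = f r"
  by (simp add: mat_def mult_delta_left)

text \<open>Gates on distinct sites multiply to the tensor power of \<open>G\<close>, whose entries
  are products over the sites. The induction treats a partial layer, which is the identity on the
  sites not yet visited.\<close>

lemma layer_vec_gate_at:
  fixes v :: "complex ^ (('n::{finite,linorder} \<Rightarrow> 'a::finite) \<times> 'b::finite)"
  shows "layer_vec (\<lambda>i. tensor_op (gate_at i G) (mat 1)) v $ (a, r)
    = (\<Sum>e\<in>UNIV. (\<Prod>i\<in>UNIV. G $ a i $ e i) * v $ (e, r))"
proof -
  have "fold (\<lambda>i v. tensor_op (gate_at i G) (mat 1) *v v) xs v $ (a, r) =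
      (\<Sum>e\<in>UNIV. (if \<forall>j. j \<notin> set xs \<longrightarrow> e j = a j then \<Prod>i\<in>set xs. G $ a i $ e i else 0) * v $ (e, r))"
    if "distinct xs" for xs
    using that
  proof (induction xs arbitrary: a rule: rev_induct)
    case Nil
    have "(\<forall>j. e j = a j) \<longleftrightarrow> e = a" for e
      by auto
    then show ?case
      by (simp add: mult_delta_left)
  next
    case (snoc i xs)
    have i: "i \<notin> set xs"
      using snoc.prems by simp
    \<comment> \<open>Matrix entry at (\<open>a\<close>, \<open>e\<close>) of the partial layer over
      \<open>xs\<close>; the condition expresses the identity on the other sites.\<close>
    define c where "c xs a e =
      (if \<forall>j. j \<notin> set xs \<longrightarrow> e j = a j then \<Prod>i\<in>set xs. G $ a i $ e i else 0)" for xs :: "'n list" and a e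
    have step: "(\<Sum>s\<in>UNIV. G $ a i $ s * c xs (a(i := s)) e) = c (xs @ [i]) a e" for e
    proof -
      \<comment> \<open>Site \<open>i\<close> is not in \<open>xs\<close>, so the earlier gates
        leave it alone: only \<open>s = e i\<close> survives.\<close>
      have "G $ a i $ s * c xs (a(i := s)) e = (if s = e i then c (xs @ [i]) a e else 0)" for s
      proof (cases "s = e i")
        case True
        define agree where "agree \<longleftrightarrow> (\<forall>j. j \<notin> set (xs @ [i]) \<longrightarrow> e j = a j)"
        let ?P = "\<Prod>k\<in>set xs. G $ a k $ e k"
        have P: "(\<Prod>k\<in>set xs. G $ (a(i := s)) k $ e k) = ?P"
          using i by (intro prod.cong) auto
        have agree: "(\<forall>j. j \<notin> set xs \<longrightarrow> e j = (a(i := s)) j) \<longleftrightarrow> agree"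
          using True by (auto simp: agree_def)
        have "c xs (a(i := s)) e = (if agree then ?P else 0)"
          by (simp only: c_def P agree)
        moreover have "(\<Prod>k\<in>set (xs @ [i]). G $ a k $ e k) = G $ a i $ e i * ?P"
          using i by simp
        then have "c (xs @ [i]) a e = (if agree then G $ a i $ e i * ?P else 0)"
          by (simp only: c_def agree_def)
        ultimately show ?thesis
          using True by simp
      next
        case False
        then have "\<not> (\<forall>j. j \<notin> set xs \<longrightarrow> e j = (a(i := s)) j)"
          using i by (metis fun_upd_same)
        then have "c xs (a(i := s)) e = 0"
          by (simp only: c_def if_False)
        then show ?thesis
          using False by simp
      qed
      then show ?thesis
        by simp
    qed
    have "fold (\<lambda>i v. tensor_op (gate_at i G) (mat 1) *v v) (xs @ [i]) v $ (a, r)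
      = (\<Sum>s\<in>UNIV. G $ a i $ s * (\<Sum>e\<in>UNIV. c xs (a(i := s)) e * v $ (e, r)))"
      using snoc by (simp add: tensor_op_mult_vec mat_1_sum gate_at_sum c_def del: fun_upd_apply)
    also have "\<dots> = (\<Sum>e\<in>UNIV. (\<Sum>s\<in>UNIV. G $ a i $ s * c xs (a(i := s)) e) * v $ (e, r))"
      unfolding sum_distrib_left sum_distrib_right
      by (subst sum.swap) (simp add: mult_ac)
    also have "\<dots> = (\<Sum>e\<in>UNIV. c (xs @ [i]) a e * v $ (e, r))"
      by (simp only: step)
    finally show ?case
      by (simp add: c_def)
  qed
  \<comment> \<open>This list contains every site, so the agreement condition becomes
    vacuous.\<close>
  from this[of "sorted_list_of_set UNIV"] show ?thesis
    by (simp add: layer_vec_def)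
qed

section \<open>Partial swaps and the controlled-SWAP layer\<close>

definition swap_on ::
  "'n set \<Rightarrow> ('n \<Rightarrow> 'd) \<times> ('n \<Rightarrow> 'd) \<Rightarrow> ('n \<Rightarrow> 'd) \<times> ('n \<Rightarrow> 'd)" where
  "swap_on S = (\<lambda>(b, c). (override_on b c S, override_on c b S))"

text \<open>Swapping a site twice undoes the swap, so composition is symmetric difference; in
  particular each \<open>swap_on S\<close> is an involution.\<close>

lemma swap_on_swap_on: "swap_on S (swap_on T r) = swap_on ((S - T) \<union> (T - S)) r"
  by (cases r) (auto simp: swap_on_def override_on_def fun_eq_iff)

lemma bij_swap_on: "bij (swap_on S)"
  by (rule o_bij[of "swap_on S"]) (auto simp: fun_eq_iff swap_on_swap_on, auto simp: swap_on_def)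

lemma cswap_gate_mult_vec:
  "(cswap_gate i *v v) $ (a, r) = v $ (a, swap_on (supp a \<inter> {i}) r)"
proof -
  have sw: "(\<Sum>r'\<in>UNIV. swap_gate i $ r $ r' * f r') = f (swap_on {i} r)"
    for f :: "('a \<Rightarrow> 'b) \<times> ('a \<Rightarrow> 'b) \<Rightarrow> complex"
  proof -
    \<comment> \<open>The swap is its own inverse, so row \<open>r\<close> of its permutation matrix
      has its single 1 in column \<open>swap_on {i} r\<close>.\<close>
    have "r = swap_sites i r' \<longleftrightarrow> r' = swap_on {i} r" for r'
      by (cases r; cases r')
        (auto simp: swap_sites_def swap_on_def override_on_def fun_eq_iff)
    then show ?thesis
      by (simp add: swap_gate_def mult_delta_left)
  qed
  have e: "swap_on {} r = r"
    by (cases r) (simp add: swap_on_def)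
  have "a i = 0 \<or> a i = 1"
    by (cases "a i") auto
  then show ?thesis
    unfolding cswap_gate_def matrix_vector_mult_add_rdistrib vector_add_component
      tensor_op_mult_vec mat_1_sum gate_at_sum sw
    by (auto simp: UNIV_bit ketbra_def axis_def supp_def e fun_upd_idem)
qed

text \<open>The gates are diagonal in the ancillas, so \<open>a\<close> stays fixed while the swaps
  at the sites with control 1 accumulate.\<close>

lemma layer_vec_cswap_gate:
  "layer_vec cswap_gate v $ (a, r) = v $ (a, swap_on (supp a) r)"
proof -
  have "fold (\<lambda>i v. cswap_gate i *v v) xs v $ (a, r) = v $ (a, swap_on (supp a \<inter> set xs) r)"
    if "distinct xs" for xs
    using that
  proof (induction xs arbitrary: r rule: rev_induct)
    case Nil
    show ?case
      by (cases r) (simp add: swap_on_def)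
  next
    case (snoc i xs)
    let ?T = "supp a \<inter> set xs" and ?I = "supp a \<inter> {i}"
    \<comment> \<open>By distinctness the two sets are disjoint, so their symmetric difference is
      their union.\<close>
    have "(?T - ?I) \<union> (?I - ?T) = supp a \<inter> set (xs @ [i])"
      using snoc.prems by auto
    then have "swap_on ?T (swap_on ?I r) = swap_on (supp a \<inter> set (xs @ [i])) r"
      by (simp only: swap_on_swap_on)
    moreover have "fold (\<lambda>i v. cswap_gate i *v v) xs v $ (a, s) = v $ (a, swap_on ?T s)" for s
      using snoc by simp
    ultimately show ?case
      by (simp only: fold_append fold_simps comp_apply cswap_gate_mult_vec)
  qed
  from this[of "sorted_list_of_set UNIV"] show ?thesis
    by (simp add: layer_vec_def)
qed

section \<open>Final state vector and outcome probabilities\<close>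

definition swap_test_vec :: "('n::{finite,linorder}, 'd::finite) state \<Rightarrow> complex ^ ('n, 'd) reg" where
  "swap_test_vec \<psi> = layer_vec hadamard_gate (layer_vec cswap_gate (layer_vec hadamard_gate
     (tensor_vec (axis (\<lambda>_. 0) 1) (tensor_vec \<psi> \<psi>))))"

text \<open>The Born rule gives the squared norm of the ancilla block \<open>z\<close> of the final
  vector. Writing it over the complex numbers lets the amplitudes be expanded bilinearly
  later.\<close>

lemma swap_test_prob_ketbra:
  "complex_of_real (swap_test_prob (ketbra \<psi>) (ketbra \<psi>) z)
    = (\<Sum>r\<in>UNIV. swap_test_vec \<psi> $ (z, r) * cnj (swap_test_vec \<psi> $ (z, r)))"
proof -
  define w where "w = swap_test_vec \<psi>"
  have fin: "swap_test_final (ketbra \<psi>) (ketbra \<psi>) = ketbra w"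
    by (simp add: swap_test_final_def swap_test_initial_def tensor_op_ketbra layer_ketbra
        w_def swap_test_vec_def)
  have entry: "(tensor_op (ketbra (axis z 1)) (mat 1) ** ketbra w) $ (a, r) $ (a, r)
      = (if a = z then w $ (z, r) * cnj (w $ (z, r)) else 0)" for a r
  proof -
    have "(tensor_op (ketbra (axis z 1)) (mat 1) ** ketbra w) $ (a, r) $ (a, r)
      = (tensor_op (ketbra (axis z 1)) (mat 1) *v w) $ (a, r) * cnj (w $ (a, r))"
      by (simp add: matrix_matrix_mult_def matrix_vector_mult_def ketbra_def sum_distrib_left
          sum_distrib_right mult_ac)
    moreover have "ketbra (axis z 1) $ a $ a' = (if a' = z then if a = z then 1 else 0 else 0)" for a'
      by (simp add: ketbra_def axis_def)
    ultimately show ?thesis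
      by (simp add: tensor_op_mult_vec mat_1_sum mult_delta_left)
  qed
  have tr: "trace (tensor_op (ketbra (axis z 1)) (mat 1) ** ketbra w)
      = (\<Sum>r\<in>UNIV. w $ (z, r) * cnj (w $ (z, r)))"
    unfolding trace_def
    by (subst sum_UNIV_prod, subst sum.swap) (simp add: entry)
  show ?thesis
    unfolding swap_test_prob_def fin tr w_def[symmetric]
    by (simp only: complex_norm_square[symmetric] of_real_sum[symmetric] Re_complex_of_real)
qed

lemma hadamard_gate_eq: "hadamard_gate = (\<lambda>i. tensor_op (gate_at i hadamard) (mat 1))"
  by (simp add: hadamard_gate_def fun_eq_iff)

lemma swap_test_vec_eq:
  fixes \<psi> :: "('n::{finite,linorder}, 'd::finite) state"
  shows "swap_test_vec \<psi> $ (z, r) = (1 / complex_of_real (sqrt 2)) ^ CARD('n) *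
    (\<Sum>a\<in>UNIV. (\<Prod>i\<in>UNIV. hadamard $ z i $ a i) * tensor_vec \<psi> \<psi> $ swap_on (supp a) r)"
proof -
  have h1: "layer_vec hadamard_gate (tensor_vec (axis (\<lambda>_. 0) 1) (tensor_vec \<psi> \<psi>)) $ (a, s)
     = (1 / complex_of_real (sqrt 2)) ^ CARD('n) * tensor_vec \<psi> \<psi> $ s" for a s
  proof -
    \<comment> \<open>The ancillas start in the all-zero state, and column 0 of
      \<open>hadamard\<close> is constantly 1 / sqrt 2, so every \<open>a\<close> gets the same
      amplitude.\<close>
    have "layer_vec hadamard_gate (tensor_vec (axis (\<lambda>_. 0) 1) (tensor_vec \<psi> \<psi>)) $ (a, s)
      = (\<Sum>e\<in>(UNIV :: ('n \<Rightarrow> bit) set). if e = (\<lambda>_. 0) then (\<Prod>i\<in>UNIV. hadamard $ a i $ 0) * tensor_vec \<psi> \<psi> $ s else 0)"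
      unfolding hadamard_gate_eq layer_vec_gate_at
      by (intro sum.cong) (auto simp: tensor_vec_def axis_def)
    then show ?thesis
      by (simp add: hadamard_def)
  qed
  show ?thesis
    unfolding swap_test_vec_def hadamard_gate_eq layer_vec_gate_at
    unfolding layer_vec_cswap_gate hadamard_gate_eq[symmetric] h1
    by (simp add: sum_distrib_left mult_ac)
qed

section \<open>Signed sum of the outcome probabilities\<close>

lemma sum_sign_hadamard:
  fixes t a e :: "'n::finite \<Rightarrow> bit"
  shows "(\<Sum>z\<in>UNIV. (- 1) ^ bit_dot z t * (\<Prod>i\<in>UNIV. hadamard $ z i $ a i) *
      cnj (\<Prod>i\<in>UNIV. hadamard $ z i $ e i)) = (if e = (\<lambda>i. a i + t i) then 1 else 0)"
proof -
  have sgn: "(- 1 :: complex) ^ bit_dot z t = (\<Prod>i\<in>UNIV. if z i = 1 \<and> t i = 1 then - 1 else 1)" for z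
  proof -
    have "supp z \<inter> supp t = {i. z i = 1 \<and> t i = 1}"
      by (auto simp: supp_def)
    then show ?thesis
      by (simp add: bit_dot_def prod.If_cases)
  qed
  define g where "g i s = (if s = 1 \<and> t i = 1 then - 1 else 1) * hadamard $ s $ a i * cnj (hadamard $ s $ e i)"
    for i s
  have half: "(1 / complex_of_real (sqrt 2)) * (1 / complex_of_real (sqrt 2)) = 1 / 2"
    by (simp flip: of_real_mult)
  \<comment> \<open>This is an entry of H Z^(t i) H = X^(t i), which flips the bit exactly when
    \<open>t i = 1\<close>; addition is mod 2.\<close>
  have site: "(\<Sum>s\<in>UNIV. g i s) = (if e i = a i + t i then 1 else 0)" for i
    using half by (cases "a i"; cases "e i"; cases "t i") (simp_all add: g_def UNIV_bit hadamard_def)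
  have "(\<Sum>z\<in>UNIV. (- 1) ^ bit_dot z t * (\<Prod>i\<in>UNIV. hadamard $ z i $ a i) *
      cnj (\<Prod>i\<in>UNIV. hadamard $ z i $ e i)) = (\<Sum>z\<in>UNIV. \<Prod>i\<in>UNIV. g i (z i))"
    by (simp add: sgn g_def prod.distrib)
  \<comment> \<open>Distributivity: choosing one term \<open>s\<close> for every site amounts to
    choosing a function \<open>z\<close>.\<close>
  also have "\<dots> = (\<Prod>i\<in>UNIV. \<Sum>s\<in>UNIV. g i s)"
    by (subst prod_sum_PiE) (auto simp: PiE_def)
  also have "\<dots> = (if e = (\<lambda>i. a i + t i) then 1 else 0)"
    by (auto simp: site fun_eq_iff)
  finally show ?thesis .
qed

lemma sum_sign_prob:
  fixes \<psi> :: "('n::{finite,linorder}, 'd::finite) state"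
  shows "complex_of_real
      (\<Sum>z\<in>UNIV. (- 1) ^ bit_dot z t * swap_test_prob (ketbra \<psi>) (ketbra \<psi>) z)
    = (\<Sum>r\<in>UNIV. tensor_vec \<psi> \<psi> $ r * cnj (tensor_vec \<psi> \<psi> $ swap_on (supp t) r))"
proof -
  define \<phi> where "\<phi> = tensor_vec \<psi> \<psi>"
  define h where "h z a = (\<Prod>i\<in>UNIV. hadamard $ z i $ a i)" for z a :: "'n \<Rightarrow> bit"
  define u where "u a r = \<phi> $ swap_on (supp a) r" for a r
  \<comment> \<open>Normalization from the first Hadamard layer only; the factors of the second
    layer stay inside \<open>h\<close>.\<close>
  define K where "K = (1 / complex_of_real (sqrt 2)) ^ CARD('n)"
  have K: "K * cnj K = 1 / 2 ^ CARD('n)"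
    by (simp add: K_def power_divide flip: power_mult_distrib of_real_mult)
  have "complex_of_real (\<Sum>z\<in>UNIV. (- 1) ^ bit_dot z t * swap_test_prob (ketbra \<psi>) (ketbra \<psi>) z)
    = (\<Sum>z\<in>UNIV. \<Sum>r\<in>UNIV. (- 1) ^ bit_dot z t *
        ((K * (\<Sum>a\<in>UNIV. h z a * u a r)) * cnj (K * (\<Sum>e\<in>UNIV. h z e * u e r))))"
    by (simp add: swap_test_prob_ketbra swap_test_vec_eq sum_distrib_left h_def u_def \<phi>_def K_def
        del: complex_cnj_mult)
  also have "\<dots> = K * cnj K * (\<Sum>z\<in>UNIV. \<Sum>r\<in>UNIV. \<Sum>a\<in>UNIV. \<Sum>e\<in>UNIV.
        ((- 1) ^ bit_dot z t * h z a * cnj (h z e)) * (u a r * cnj (u e r)))"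
  proof -
    have "(- 1) ^ bit_dot z t * ((K * (\<Sum>a\<in>UNIV. h z a * u a r)) * cnj (K * (\<Sum>e\<in>UNIV. h z e * u e r)))
      = K * cnj K * (\<Sum>a\<in>UNIV. \<Sum>e\<in>UNIV.
          ((- 1) ^ bit_dot z t * h z a * cnj (h z e)) * (u a r * cnj (u e r)))" for z r
    proof -
      have split: "(- 1) ^ bit_dot z t * ((K * (\<Sum>a\<in>UNIV. h z a * u a r)) * cnj (K * (\<Sum>e\<in>UNIV. h z e * u e r)))
        = K * cnj K * ((- 1) ^ bit_dot z t *
            ((\<Sum>a\<in>UNIV. h z a * u a r) * (\<Sum>e\<in>UNIV. cnj (h z e * u e r))))"
        by simp
      show ?thesis
        unfolding split sum_product by (simp add: sum_distrib_left mult_ac)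
    qed
    then show ?thesis
      by (simp only: sum_distrib_left)
  qed
  \<comment> \<open>The sum over \<open>z\<close> moves innermost, where for each pair of branches
    \<open>a\<close>, \<open>e\<close> it is the sum of \<open>sum_sign_hadamard\<close> and keeps
    only \<open>e = a + t\<close>.\<close>
  also have "\<dots> = K * cnj K * (\<Sum>r\<in>UNIV. \<Sum>a\<in>UNIV. \<Sum>e\<in>UNIV.
        (\<Sum>z\<in>UNIV. (- 1) ^ bit_dot z t * h z a * cnj (h z e)) * (u a r * cnj (u e r)))"
    unfolding sum_distrib_right
    apply (rule arg_cong[where f = "(*) (K * cnj K)"])
    apply (rule trans[OF sum.swap], rule sum.cong, rule refl)
    apply (rule trans[OF sum.swap], rule sum.cong, rule refl)
    apply (rule sum.swap)
    done
  also have "\<dots> = K * cnj K * (\<Sum>r\<in>UNIV. \<Sum>a\<in>UNIV. u a r * cnj (u (\<lambda>i. a i + t i) r))"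
    by (simp only: h_def sum_sign_hadamard mult_delta_left mult_1_left sum.delta finite UNIV_I if_True)
  also have "\<dots> = K * cnj K * (\<Sum>a\<in>UNIV. \<Sum>r\<in>UNIV. u a r * cnj (u (\<lambda>i. a i + t i) r))"
    by (subst sum.swap) simp
  also have "\<dots> = K * cnj K * (\<Sum>a\<in>(UNIV :: ('n \<Rightarrow> bit) set).
      \<Sum>r\<in>UNIV. \<phi> $ r * cnj (\<phi> $ swap_on (supp t) r))"
  proof -
    have "(\<Sum>r\<in>UNIV. u a r * cnj (u (\<lambda>i. a i + t i) r))
      = (\<Sum>r\<in>UNIV. \<phi> $ r * cnj (\<phi> $ swap_on (supp t) r))" for a
    proof -
      have "supp (\<lambda>i. a i + t i) = (supp t - supp a) \<union> (supp a - supp t)"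
        by (auto simp: supp_def)
      then have "u (\<lambda>i. a i + t i) r = \<phi> $ swap_on (supp t) (swap_on (supp a) r)" for r
        by (simp add: u_def swap_on_swap_on)
      then have "(\<Sum>r\<in>UNIV. u a r * cnj (u (\<lambda>i. a i + t i) r))
        = (\<Sum>r\<in>UNIV. \<phi> $ swap_on (supp a) r * cnj (\<phi> $ swap_on (supp t) (swap_on (supp a) r)))"
        by (simp add: u_def)
      \<comment> \<open>Reindexing by the permutation \<open>swap_on (supp a)\<close> removes the
        dependence on \<open>a\<close>.\<close>
      also have "\<dots> = (\<Sum>r\<in>UNIV. \<phi> $ r * cnj (\<phi> $ swap_on (supp t) r))"
        by (rule sum.reindex_bij_betw[OF bij_swap_on])
      finally show ?thesis .
    qed
    then show ?thesis
      by simp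
  qed
  \<comment> \<open>The 2 ^ n equal terms cancel the factor \<open>K * cnj K\<close>.\<close>
  also have "\<dots> = (\<Sum>r\<in>UNIV. \<phi> $ r * cnj (\<phi> $ swap_on (supp t) r))"
    by (simp add: K card_fun UNIV_bit)
  finally show ?thesis
    by (simp add: \<phi>_def)
qed

section \<open>Purity as a swap expectation\<close>

lemma sum_UNIV_override_on:
  fixes f :: "('n::finite \<Rightarrow> 'd::finite) \<Rightarrow> 'c::comm_monoid_add"
  shows "(\<Sum>b\<in>UNIV. f b)
    = (\<Sum>x\<in>S \<rightarrow>\<^sub>E UNIV. \<Sum>w\<in>(- S) \<rightarrow>\<^sub>E UNIV. f (override_on w x S))"
proof -
  have glue: "override_on (restrict b (- S)) (restrict b S) S = b" for b :: "'n \<Rightarrow> 'd"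
    by (auto simp: override_on_def)
  have "(\<Sum>b\<in>UNIV. f b)
    = (\<Sum>p\<in>(S \<rightarrow>\<^sub>E UNIV) \<times> ((- S) \<rightarrow>\<^sub>E UNIV). f (override_on (snd p) (fst p) S))"
    by (rule sum.reindex_bij_witness[where i = "\<lambda>p. override_on (snd p) (fst p) S"
          and j = "\<lambda>b. (restrict b S, restrict b (- S))"])
      (simp_all add: glue, auto simp: override_on_def fun_eq_iff PiE_def extensional_def)
  then show ?thesis
    by (simp add: sum.cartesian_product case_prod_unfold)
qed

text \<open>The swap trick: the matrix product contracts the \<open>S\<close>-indices of two copies
  crosswise, while each partial trace contracts the indices off \<open>S\<close> within its own
  copy.\<close>

lemma purity_ketbra:
  "purity S (ketbra \<psi>) = Re (\<Sum>r\<in>UNIV. tensor_vec \<psi> \<psi> $ r * cnj (tensor_vec \<psi> \<psi> $ swap_on S r))"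
proof -
  have "op_trace_on (S \<rightarrow>\<^sub>E UNIV) (op_mult_on (S \<rightarrow>\<^sub>E UNIV)
        (reduced_state S (ketbra \<psi>)) (reduced_state S (ketbra \<psi>)))
    = (\<Sum>x\<in>S \<rightarrow>\<^sub>E UNIV. \<Sum>k\<in>S \<rightarrow>\<^sub>E UNIV. \<Sum>w\<in>(- S) \<rightarrow>\<^sub>E UNIV. \<Sum>w'\<in>(- S) \<rightarrow>\<^sub>E UNIV.
        (\<psi> $ override_on w x S * cnj (\<psi> $ override_on w k S)) *
        (\<psi> $ override_on w' k S * cnj (\<psi> $ override_on w' x S)))"
    by (simp add: op_trace_on_def op_mult_on_def reduced_state_def ketbra_def sum_product)
  \<comment> \<open>Regrouped so that (\<open>x\<close>, \<open>w\<close>) assembles into a full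
    index \<open>b\<close> and (\<open>k\<close>, \<open>w'\<close>) into \<open>c\<close>.\<close>
  also have "\<dots> = (\<Sum>x\<in>S \<rightarrow>\<^sub>E UNIV. \<Sum>w\<in>(- S) \<rightarrow>\<^sub>E UNIV. \<Sum>k\<in>S \<rightarrow>\<^sub>E UNIV. \<Sum>w'\<in>(- S) \<rightarrow>\<^sub>E UNIV.
        (\<psi> $ override_on w x S * cnj (\<psi> $ override_on w k S)) *
        (\<psi> $ override_on w' k S * cnj (\<psi> $ override_on w' x S)))"
    by (intro sum.cong refl sum.swap)
  also have "\<dots> = (\<Sum>b\<in>UNIV. \<Sum>c\<in>UNIV. \<psi> $ b * \<psi> $ c *
      cnj (\<psi> $ override_on b c S * \<psi> $ override_on c b S))"
  proof -
    \<comment> \<open>In terms of \<open>b\<close> and \<open>c\<close>, the mixed indices are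
      exactly those obtained by exchanging the parts on \<open>S\<close>.\<close>
    have ov: "override_on (override_on w x S) (override_on w' k S) S = override_on w k S" for w x w' k
      by (auto simp: override_on_def fun_eq_iff)
    show ?thesis
      unfolding sum_UNIV_override_on[where S = S] ov
      by (simp add: mult_ac)
  qed
  also have "\<dots> = (\<Sum>r\<in>UNIV. tensor_vec \<psi> \<psi> $ r * cnj (tensor_vec \<psi> \<psi> $ swap_on S r))"
    by (simp add: sum_UNIV_prod tensor_vec_def swap_on_def)
  finally show ?thesis
    by (simp add: purity_def)
qed

theorem proposition11:
  fixes \<psi> :: "('n::{finite,linorder}, 'd::finite) state"
    and m :: nat
    and S :: "nat \<Rightarrow> 'n set"
    and t :: "nat \<Rightarrow> 'n \<Rightarrow> bit"
  assumes "pure_state \<psi>"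
    and "m \<ge> 1"
    and "S ` {1..m} \<noteq> {{}}"
    and "\<And>i. i \<in> {1..m} \<Longrightarrow> supp (t i) = S i"
  shows "fixed_partition_measure m S \<psi> =
    1 - 1 / real m * (\<Sum>i = 1..m. \<Sum>z\<in>UNIV.
      (- 1) ^ bit_dot z (t i) * swap_test_prob (ketbra \<psi>) (ketbra \<psi>) z)"
proof -
  have "purity (S i) (ketbra \<psi>) =
      (\<Sum>z\<in>UNIV. (- 1) ^ bit_dot z (t i) * swap_test_prob (ketbra \<psi>) (ketbra \<psi>) z)"
    if "i \<in> {1..m}" for i
    \<comment> \<open>The swap expectation is the embedding of a real sum, so \<open>Re\<close>
      returns that sum.\<close>
    unfolding purity_ketbra assms(4)[OF that, symmetric] sum_sign_prob[symmetric] by simp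
  then show ?thesis
    by (simp add: fixed_partition_measure_def)
qed

end
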